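(* For $(\underline{s}_1,\underline{s}_2,\overline{s}_1,\overline{s}_2)\in\mathbb{D}$ and $i\in\{-1,0,1\}$ we have $$\mathbf{t}^{(i,-1)}(\underline{s}_1,\underline{s}_2,\overline{s}_1,\overline{s}_2)=\mathbf{t}^{(i,-1)}(\underline{s}_1,\underline{s}_2,\overline{s}_1,\underline{s}_2).$$
   Context: $\mathbb{R}_+=[0,\infty)$. $\mathbb{D}=\{(\underline{s}_1,\underline{s}_2,\overline{s}_1,\overline{s}_2)\in\mathbb{R}_+^2\times\mathbb{R}_+^2:\ 0<\underline{s}_1\le\overline{s}_1,\ 0<\underline{s}_2\le\overline{s}_2\}$. For $(x,y_1,y_2)\in\mathbb{R}_+\times\mathbb{R}_+^2$ and prices in $\mathbb{D}$, $\mathbb{A}(x,y_1,y_2,\underline{s}_1,\underline{s}_2,\overline{s}_1,\overline{s}_2)$ is the set of all $(l_1,l_2,m_1,m_2)\in\mathbb{R}_+^2\times\mathbb{R}_+^2$ with $0\le x+\underline{s}_1m_1+\underline{s}_2m_2-\overline{s}_1l_1-\overline{s}_2l_2$, $0\le y_i-m_i+l_i$ and $m_i\le y_i$ for $i=1,2$. $g:\mathbb{R}_+\times\mathbb{R}_+^2\to\mathbb{R}\cup\{-\infty\}$ is a fixed strictly concave function, strictly increasing with respect to each variable; $$\varphi(x,y_1,y_2,\underline{s}_1,\underline{s}_2,\overline{s}_1,\overline{s}_2,l_1,l_2,m_1,m_2)=g\big(x+\underline{s}_1m_1+\underline{s}_2m_2-\overline{s}_1l_1-\overline{s}_2l_2,\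 y_1-m_1+l_1,\ y_2-m_2+l_2\big),$$ and $\Phi(x,y_1,y_2,\underline{s}_1,\underline{s}_2,\overline{s}_1,\overline{s}_2)$ is the supremum of $\varphi$ over $(l_1,l_2,m_1,m_2)\in\mathbb{A}(x,y_1,y_2,\underline{s}_1,\underline{s}_2,\overline{s}_1,\overline{s}_2)$. For $(i_1,i_2)\in\{-1,0,1\}^2$, $\mathbb{A}^{(i_1,i_2)}(x,y_1,y_2,\underline{s}_1,\underline{s}_2,\overline{s}_1,\overline{s}_2)$ is the set of $(l_1,l_2,m_1,m_2)\in\mathbb{A}(x,y_1,y_2,\underline{s}_1,\underline{s}_2,\overline{s}_1,\overline{s}_2)$ with $i_1=\operatorname{sgn}(l_1-m_1)$, $i_2=\operatorname{sgn}(l_2-m_2)$, $l_1m_1+l_2m_2=0$ (with $\operatorname{sgn}\in\{-1,0,1\}$). The trading set $\mathbf{t}^{(i_1,i_2)}(\underline{s}_1,\underline{s}_2,\overline{s}_1,\overline{s}_2)$ is the set of $(x,y_1,y_2)\in\mathbb{R}_+\times\mathbb{R}_+^2$ for which there is $(l_1,l_2,m_1,m_2)\in\mathbb{A}^{(i_1,i_2)}(x,y_1,y_2,\underline{s}_1,\underline{s}_2,\overline{s}_1,\overline{s}_2)$ with $\Phi(x,y_1,y_2,\underline{s}_1,\underline{s}_2,\overline{s}_1,\overline{s}_2)=\varphi(x,y_1,y_2,\underline{s}_1,\underline{s}_2,\overline{s}_1,\overline{s}_2,l_1,l_2,m_1,m_2)$. Arguments are always ordered (bid 1, bid 2, ask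 1, ask 2). *)

theory Defs
  imports "HOL-Analysis.Analysis"
begin

type_synonym position = "real \<times> real \<times> real"          \<comment> \<open>\<open>(x, y\<^sub>1, y\<^sub>2)\<close>\<close>
type_synonym prices = "real \<times> real \<times> real \<times> real"     \<comment> \<open>(bid 1, bid 2, ask 1, ask 2)\<close>
type_synonym trade = "real \<times> real \<times> real \<times> real"      \<comment> \<open>\<open>(l\<^sub>1, l\<^sub>2, m\<^sub>1, m\<^sub>2)\<close>: purchases, sales\<close>

definition positions :: "position set" where
  "positions = {(x, y1, y2). 0 \<le> x \<and> 0 \<le> y1 \<and> 0 \<le> y2}"

definition price_domain :: "prices set" where
  "price_domain = {(b1, b2, a1, a2). 0 < b1 \<and> b1 \<le> a1 \<and> 0 < b2 \<and> b2 \<le> a2}"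

text \<open>
  The utility takes values in \<open>\<real> \<union> {-\<infinity>}\<close>, rendered as an \<^typ>\<open>ereal\<close>-valued function that is
  never \<open>\<infinity>\<close> on \<^const>\<open>positions\<close>; hence the sum in \<open>strictly_concave\<close> is never \<open>\<infinity> - \<infinity>\<close>.
  Values outside \<^const>\<open>positions\<close> are irrelevant.
\<close>

definition strictly_concave :: "(position \<Rightarrow> ereal) \<Rightarrow> bool" where
  "strictly_concave g \<longleftrightarrow>
     (\<forall>p \<in> positions. \<forall>q \<in> positions. \<forall>t::real. p \<noteq> q \<longrightarrow> 0 < t \<longrightarrow> t < 1 \<longrightarrow>
        ereal t * g p + ereal (1 - t) * g q < g (t *\<^sub>R p + (1 - t) *\<^sub>R q))"

definition strictly_increasing :: "(position \<Rightarrow> ereal) \<Rightarrow> bool" where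
  "strictly_increasing g \<longleftrightarrow>
     (\<forall>y1\<ge>0. \<forall>y2\<ge>0. strict_mono_on {0..} (\<lambda>x. g (x, y1, y2))) \<and>
     (\<forall>x\<ge>0. \<forall>y2\<ge>0. strict_mono_on {0..} (\<lambda>y1. g (x, y1, y2))) \<and>
     (\<forall>x\<ge>0. \<forall>y1\<ge>0. strict_mono_on {0..} (\<lambda>y2. g (x, y1, y2)))"

fun admissible :: "position \<Rightarrow> prices \<Rightarrow> trade set" where
  "admissible (x, y1, y2) (b1, b2, a1, a2) =
     {(l1, l2, m1, m2).
        0 \<le> l1 \<and> 0 \<le> l2 \<and> 0 \<le> m1 \<and> 0 \<le> m2 \<and>
        0 \<le> x + b1 * m1 + b2 * m2 - a1 * l1 - a2 * l2 \<and>
        0 \<le> y1 - m1 + l1 \<and> 0 \<le> y2 - m2 + l2 \<and>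
        m1 \<le> y1 \<and> m2 \<le> y2}"

fun trade_utility :: "(position \<Rightarrow> ereal) \<Rightarrow> position \<Rightarrow> prices \<Rightarrow> trade \<Rightarrow> ereal" where
  "trade_utility g (x, y1, y2) (b1, b2, a1, a2) (l1, l2, m1, m2) =
     g (x + b1 * m1 + b2 * m2 - a1 * l1 - a2 * l2, y1 - m1 + l1, y2 - m2 + l2)"

definition max_utility :: "(position \<Rightarrow> ereal) \<Rightarrow> position \<Rightarrow> prices \<Rightarrow> ereal" where
  "max_utility g p s = (SUP u \<in> admissible p s. trade_utility g p s u)"

definition admissible_dir :: "int \<Rightarrow> int \<Rightarrow> position \<Rightarrow> prices \<Rightarrow> trade set" where
  "admissible_dir i1 i2 p s =
     {(l1, l2, m1, m2). (l1, l2, m1, m2) \<in> admissible p s \<and>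
        real_of_int i1 = sgn (l1 - m1) \<and> real_of_int i2 = sgn (l2 - m2) \<and>
        l1 * m1 + l2 * m2 = 0}"

definition trading_set :: "(position \<Rightarrow> ereal) \<Rightarrow> int \<Rightarrow> int \<Rightarrow> prices \<Rightarrow> position set" where
  "trading_set g i1 i2 s =
     {p \<in> positions. \<exists>u \<in> admissible_dir i1 i2 p s. max_utility g p s = trade_utility g p s u}"

end

theory Submission
  imports Defs
begin

text \<open>
  A trade that is a net sale of the second asset never buys that asset, because no asset is bought
  and sold at once. Hence its cash flow does not see the second ask price, and the only thing that
  the ask price can change is the class of competing trades. Lowering the ask price to the bid
  price can only raise the supremum (\<open>max_utility_antimono_ask2\<close>), so an optimal net sale in the
  market with equal second prices stays optimal in the original market.

  The converse is a local-versus-global argument (\<open>optimal_sale_ask2_reduced\<close>). If some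
  trade beats the optimal sale once the ask price has been lowered, then so does, by strict
  concavity, every strict mixture of the two. A mixture close enough to the sale is still a net
  sale of the second asset. With equal bid and ask price its purchases and sales of that asset can
  be cancelled against each other without changing the final position (\<open>net_sale_admissible\<close>), and
  the resulting trade is available in the original market. This contradicts optimality there.
\<close>

text \<open>
  The weighted mean in the definition of strict concavity is at least the smaller of the two
  values: this is trivial if that value is \<open>-\<infinity>\<close>, and otherwise both values are real numbers.
\<close>

lemma strictly_concave_mixture_improves:
  fixes g :: "position \<Rightarrow> ereal" and t :: real
  assumes conc: "strictly_concave g"
    and pq: "p \<in> positions" "q \<in> positions"
    and fin: "g q \<noteq> \<infinity>"
    and less: "g p < g q"
    and t: "0 < t" "t < 1"
  shows "g p < g (t *\<^sub>R q + (1 - t) *\<^sub>R p)"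
proof -
  have "q \<noteq> p" using less by auto
  then have mid: "ereal t * g q + ereal (1 - t) * g p < g (t *\<^sub>R q + (1 - t) *\<^sub>R p)"
    using conc pq t by (auto simp: strictly_concave_def)
  have "g p \<le> ereal t * g q + ereal (1 - t) * g p"
  proof (cases "g p")
    case (real a)
    then obtain b where b: "g q = ereal b" using less fin by (cases "g q") auto
    have "t * a \<le> t * b" using less real b t by simp
    then show ?thesis using real b by (simp add: algebra_simps)
  qed (use less in auto)
  then show ?thesis using mid by (rule le_less_trans)
qed

lemma strictly_increasing_cash_mono:
  assumes "strictly_increasing g" "0 \<le> x" "x \<le> x'" "0 \<le> y1" "0 \<le> y2"
  shows "g (x, y1, y2) \<le> g (x', y1, y2)"
proof -
  have "strict_mono_on {0..} (\<lambda>x. g (x, y1, y2))"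
    using assms by (auto simp: strictly_increasing_def)
  from strict_mono_onD[OF this, of x x'] show ?thesis
    using assms by (cases "x = x'") auto
qed

lemma net_sale_dirD:
  assumes "(l1, l2, m1, m2) \<in> admissible_dir i (-1) (x, y1, y2) (b1, b2, a1, a2)"
  shows "l2 = 0" "0 < m2"
proof -
  have nonneg: "0 \<le> l1" "0 \<le> l2" "0 \<le> m1" "0 \<le> m2"
    and "sgn (l2 - m2) = - 1" and compl: "l1 * m1 + l2 * m2 = 0"
    using assms by (auto simp: admissible_dir_def)
  then have "l2 < m2" by (auto simp: sgn_if split: if_splits)
  then show "0 < m2" using nonneg by linarith
  moreover have "l2 * m2 = 0"
    using compl nonneg by (simp add: add_nonneg_eq_0_iff)
  ultimately show "l2 = 0" by simp
qed

lemma net_sale_dir_ask2_irrelevant: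
  "admissible_dir i (-1) (x, y1, y2) (b1, b2, a1, a2) =
   admissible_dir i (-1) (x, y1, y2) (b1, b2, a1, a2')"
proof -
  have "u \<in> admissible_dir i (-1) (x, y1, y2) (b1, b2, a1, c')"
    if u: "u \<in> admissible_dir i (-1) (x, y1, y2) (b1, b2, a1, c)" for u c c'
  proof -
    obtain l1 l2 m1 m2 where u_eq: "u = (l1, l2, m1, m2)" by (cases u)
    have "l2 = 0" using u net_sale_dirD(1) unfolding u_eq by blast
    then show ?thesis using u by (simp add: u_eq admissible_dir_def)
  qed
  then show ?thesis by blast
qed

lemma trade_utility_le_max_utility:
  "u \<in> admissible p s \<Longrightarrow> trade_utility g p s u \<le> max_utility g p s"
  unfolding max_utility_def by (rule SUP_upper)

text \<open>
  Every trade stays feasible when purchases become cheaper, and the cash saved on it can only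
  increase the utility of the final position.
\<close>

lemma max_utility_antimono_ask2:
  assumes inc: "strictly_increasing g" and "a2' \<le> a2"
  shows "max_utility g (x, y1, y2) (b1, b2, a1, a2) \<le> max_utility g (x, y1, y2) (b1, b2, a1, a2')"
  unfolding max_utility_def
proof (rule SUP_mono)
  fix u assume u: "u \<in> admissible (x, y1, y2) (b1, b2, a1, a2)"
  obtain l1 l2 m1 m2 where u_eq: "u = (l1, l2, m1, m2)" by (cases u)
  have cost: "a2' * l2 \<le> a2 * l2"
    using u assms by (auto simp: u_eq intro: mult_right_mono)
  have "u \<in> admissible (x, y1, y2) (b1, b2, a1, a2')"
    using u cost by (auto simp: u_eq)
  moreover have "trade_utility g (x, y1, y2) (b1, b2, a1, a2) u
      \<le> trade_utility g (x, y1, y2) (b1, b2, a1, a2') u"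
    using u cost by (auto simp: u_eq intro!: strictly_increasing_cash_mono[OF inc])
  ultimately show "\<exists>v \<in> admissible (x, y1, y2) (b1, b2, a1, a2').
      trade_utility g (x, y1, y2) (b1, b2, a1, a2) u
      \<le> trade_utility g (x, y1, y2) (b1, b2, a1, a2') v"
    by blast
qed

text \<open>
  Buying and selling the second asset at the same price is the same as trading the difference.
  Once a net sale is written with no purchase, it yields the same cash at any second ask price.
\<close>

lemma net_sale_admissible:
  assumes "(l1, l2, m1, m2) \<in> admissible (x, y1, y2) (b1, b2, a1, b2)" and "l2 \<le> m2"
  shows "(l1, 0, m1, m2 - l2) \<in> admissible (x, y1, y2) (b1, b2, a1, a2)"
    and "trade_utility g (x, y1, y2) (b1, b2, a1, a2) (l1, 0, m1, m2 - l2) =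
         trade_utility g (x, y1, y2) (b1, b2, a1, b2) (l1, l2, m1, m2)"
  using assms by (auto simp: algebra_simps)

lemma admissible_mixture:
  fixes t :: real
  assumes "u \<in> admissible p s" "v \<in> admissible p s" "0 \<le> t" "t \<le> 1"
  shows "t *\<^sub>R u + (1 - t) *\<^sub>R v \<in> admissible p s"
proof -
  obtain x y1 y2 b1 b2 a1 a2 where p: "p = (x, y1, y2)" and s: "s = (b1, b2, a1, a2)"
    by (cases p, cases s)
  obtain l1 l2 m1 m2 k1 k2 n1 n2 where u: "u = (l1, l2, m1, m2)" and v: "v = (k1, k2, n1, n2)"
    by (cases u, cases v)
  \<comment> \<open>An affine constraint holds at the mixture because its slack there is the mixture of slacks.\<close>
  have mix: "0 \<le> t * c + (1 - t) * d" if "0 \<le> c" "0 \<le> d" for c d :: real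
    using that assms(3,4) by simp
  show ?thesis
    using assms(1,2)
      mix[of l1 k1] mix[of l2 k2] mix[of m1 n1] mix[of m2 n2]
      mix[of "x + b1 * m1 + b2 * m2 - a1 * l1 - a2 * l2"
             "x + b1 * n1 + b2 * n2 - a1 * k1 - a2 * k2"]
      mix[of "y1 - m1 + l1" "y1 - n1 + k1"] mix[of "y2 - m2 + l2" "y2 - n2 + k2"]
      mix[of "y1 - m1" "y1 - n1"] mix[of "y2 - m2" "y2 - n2"]
    unfolding p s u v by (simp add: algebra_simps)
qed

text \<open>
  A better trade at the reduced ask price need not be a net sale of the second asset, so it may be
  infeasible or inferior in the original market. Moving only slightly from the optimal sale towards it gives
  a trade that is still a net sale, and concavity makes even this slight move an improvement.
\<close>

lemma optimal_sale_ask2_reduced: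
  fixes g :: "position \<Rightarrow> ereal"
  assumes fin: "\<And>p. p \<in> positions \<Longrightarrow> g p \<noteq> \<infinity>"
    and conc: "strictly_concave g"
    and sale: "(l1, 0, m1, m2) \<in> admissible (x, y1, y2) (b1, b2, a1, a2)" "0 < m2"
    and opt: "max_utility g (x, y1, y2) (b1, b2, a1, a2) =
      trade_utility g (x, y1, y2) (b1, b2, a1, a2) (l1, 0, m1, m2)"
  shows "max_utility g (x, y1, y2) (b1, b2, a1, b2) \<le>
    trade_utility g (x, y1, y2) (b1, b2, a1, b2) (l1, 0, m1, m2)"
  unfolding max_utility_def
proof (rule SUP_least, rule ccontr)
  let ?p = "(x, y1, y2)" and ?s = "(b1, b2, a1, a2)" and ?s' = "(b1, b2, a1, b2)"
  let ?u = "(l1, 0, m1, m2)"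
  fix v assume v: "v \<in> admissible ?p ?s'"
    and "\<not> trade_utility g ?p ?s' v \<le> trade_utility g ?p ?s' ?u"
  then have better: "trade_utility g ?p ?s' ?u < trade_utility g ?p ?s' v" by simp
  obtain k1 k2 n1 n2 where v_eq: "v = (k1, k2, n1, n2)" by (cases v)
  have u: "?u \<in> admissible ?p ?s'" using sale by simp
  have nonneg: "0 \<le> k2" "0 \<le> n2" using v by (auto simp: v_eq)
  \<comment> \<open>This weight on \<open>v\<close> makes the purchase \<open>t * k2\<close> in the mixture smaller than the sale
     \<open>(1 - t) * m2\<close>; the summand 1 keeps it below 1 also when \<open>v\<close> does not buy.\<close>
  define t where "t = m2 / (m2 + k2 + 1)"
  have t: "0 < t" "t < 1" using sale(2) nonneg by (auto simp: t_def field_simps)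
  have "t * k2 \<le> (1 - t) * m2" using sale(2) nonneg by (simp add: t_def field_simps)
  moreover have "0 \<le> t * n2" using t nonneg by simp
  ultimately have net: "t * k2 \<le> t * n2 + (1 - t) * m2" by linarith
  define P where "P = (x + b1 * m1 + b2 * m2 - a1 * l1, y1 - m1 + l1, y2 - m2)"
  define Q where "Q = (x + b1 * n1 + b2 * n2 - a1 * k1 - b2 * k2, y1 - n1 + k1, y2 - n2 + k2)"
  have PQ: "P \<in> positions" "Q \<in> positions"
    using u v by (auto simp: P_def Q_def v_eq positions_def)
  have gP: "trade_utility g ?p ?s' ?u = g P" "trade_utility g ?p ?s ?u = g P"
    by (simp_all add: P_def)
  have gQ: "trade_utility g ?p ?s' v = g Q" by (simp add: Q_def v_eq)
  let ?w = "t *\<^sub>R v + (1 - t) *\<^sub>R ?u"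
  have w_eq: "?w = (t * k1 + (1 - t) * l1, t * k2, t * n1 + (1 - t) * m1, t * n2 + (1 - t) * m2)"
    by (simp add: v_eq)
  have w: "?w \<in> admissible ?p ?s'" using admissible_mixture[OF v u] t by simp
  have "trade_utility g ?p ?s' ?w = g (t *\<^sub>R Q + (1 - t) *\<^sub>R P)"
    unfolding w_eq P_def Q_def by (simp add: algebra_simps)
  moreover have "g P < g (t *\<^sub>R Q + (1 - t) *\<^sub>R P)"
    using strictly_concave_mixture_improves[OF conc PQ fin[OF PQ(2)]] better gP gQ t by simp
  moreover have "trade_utility g ?p ?s' ?w \<le> max_utility g ?p ?s"
    unfolding w_eq net_sale_admissible(2)[OF w[unfolded w_eq] net, of g a2, symmetric]
    by (rule trade_utility_le_max_utility) (rule net_sale_admissible(1)[OF w[unfolded w_eq] net])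
  ultimately show False using opt gP by simp
qed

theorem corollary6p3:
  fixes g :: "position \<Rightarrow> ereal" and i :: int and b1 b2 a1 a2 :: real
  assumes "\<And>p. p \<in> positions \<Longrightarrow> g p \<noteq> \<infinity>"
    and "strictly_concave g"
    and "strictly_increasing g"
    and "(b1, b2, a1, a2) \<in> price_domain"
    and "i \<in> {-1, 0, 1}"
  shows "trading_set g i (-1) (b1, b2, a1, a2) = trading_set g i (-1) (b1, b2, a1, b2)"
proof -
  let ?s = "(b1, b2, a1, a2)" and ?s' = "(b1, b2, a1, b2)"
  have ask: "b2 \<le> a2" using assms(4) by (simp add: price_domain_def)
  have dir_eq: "admissible_dir i (-1) p ?s = admissible_dir i (-1) p ?s'" for p
    using net_sale_dir_ask2_irrelevant by (cases p) blast
  have optimal_iff: "max_utility g p ?s = trade_utility g p ?s u \<longleftrightarrow>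
      max_utility g p ?s' = trade_utility g p ?s' u"
    if dir: "u \<in> admissible_dir i (-1) p ?s" for p u
  proof -
    obtain x y1 y2 where p: "p = (x, y1, y2)" by (cases p)
    obtain l1 l2 m1 m2 where u': "u = (l1, l2, m1, m2)" by (cases u)
    have u: "u = (l1, 0, m1, m2)" and m2: "0 < m2"
      using net_sale_dirD[OF dir[unfolded p u']] u' by simp_all
    have adm: "u \<in> admissible p ?s" "u \<in> admissible p ?s'"
      using dir by (auto simp: p u admissible_dir_def)
    have same: "trade_utility g p ?s u = trade_utility g p ?s' u" by (simp add: p u)
    show ?thesis
    proof
      assume "max_utility g p ?s = trade_utility g p ?s u"
      then have "max_utility g p ?s' \<le> trade_utility g p ?s' u"
        using optimal_sale_ask2_reduced[OF assms(1,2)] adm m2 unfolding p u by blast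
      then show "max_utility g p ?s' = trade_utility g p ?s' u"
        using trade_utility_le_max_utility[OF adm(2)] by (rule antisym)
    next
      assume "max_utility g p ?s' = trade_utility g p ?s' u"
      then have "max_utility g p ?s \<le> trade_utility g p ?s u"
        using max_utility_antimono_ask2[OF assms(3) ask] same unfolding p by metis
      then show "max_utility g p ?s = trade_utility g p ?s u"
        using trade_utility_le_max_utility[OF adm(1)] by (rule antisym)
    qed
  qed
  show ?thesis
    unfolding trading_set_def using optimal_iff dir_eq by blast
qed

end
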